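(* Fix real numbers $p,r,s>0$. Let $W$ be a non-negative random variable with $0<\mathbb{E} W^{s/p}<\infty$. Then $W$ has the distribution of $c\,G_r^p$ for some constant $c>0$ if and only if $$W \stackrel{d}{=} B_{r,s}^p\, W^{(s/p)},$$ where $W^{(s/p)}$ has the $(s/p)$-power bias distribution of $W$ and $B_{r,s}$ is independent of $W^{(s/p)}$.
   Context: $\stackrel{d}{=}$ denotes equality in distribution. For $r,s>0$, $G_r$ denotes a standard gamma random variable with density $\frac{1}{\Gamma(r)}x^{r-1}e^{-x}$, $x>0$, and $B_{r,s}$ denotes a beta random variable with density $\frac{\Gamma(r+s)}{\Gamma(r)\Gamma(s)}y^{r-1}(1-y)^{s-1}$, $0<y<1$, where $\Gamma$ is the gamma function. For $\alpha>0$ and a random variable $X$ with distribution function $F$ and $0<\mathbb{E}|X|^\alpha<\infty$, the $\alpha$-power bias distribution $F^{(\alpha)}$ of $X$ is defined by $dF^{(\alpha)}(x)=|x|^\alpha dF(x)/\mathbb{E}|X|^\alpha$, and $X^{(\alpha)}$ denotes a random variable with this distribution; equivalently $\mathbb{E} f(X^{(\alpha)})=\mathbb{E}[|X|^\alpha f(X)]/\mathbb{E}|X|^\alpha$ for every measurable $f$ with $\mathbb{E}|X|^\alpha|f(X)|<\infty$. *)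

theory Defs
  imports "HOL-Probability.Probability"
begin

definition gamma_density :: "real \<Rightarrow> real \<Rightarrow> real" where
  "gamma_density r x = (if 0 < x then x powr (r - 1) * exp (- x) / Gamma r else 0)"

definition beta_density :: "real \<Rightarrow> real \<Rightarrow> real \<Rightarrow> real" where
  "beta_density r s y =
     (if 0 < y \<and> y < 1
      then Gamma (r + s) / (Gamma r * Gamma s) * y powr (r - 1) * (1 - y) powr (s - 1)
      else 0)"

text \<open>The \<open>a\<close>-power bias of a law \<open>F\<close> on the reals. It is the intended law only
  when the absolute moment of order \<open>a\<close> is finite and positive.\<close>

definition power_bias :: "real \<Rightarrow> real measure \<Rightarrow> real measure" where
  "power_bias a F = density F (\<lambda>x. ennreal (\<bar>x\<bar> powr a / (\<integral>y. \<bar>y\<bar> powr a \<partial>F)))"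

end

theory Submission
  imports Defs "HOL-Complex_Analysis.Complex_Analysis" "HOL-Real_Asymp.Real_Asymp"
begin

text \<open>
  Write \<open>\<Phi> t\<close> for the moment of order \<open>t\<close> of \<open>W\<close>, and put \<open>a = s / p\<close> and \<open>m = \<Phi> a\<close>. Independence,
  the moments of the beta law and the fact that power bias shifts the order of moments turn
  \<open>W = B powr p * V\<close> in law into the functional equation
  \<open>\<Phi> t = Gamma (r + p t) * Gamma (r + s) / (Gamma r * Gamma (r + p t + s)) * (\<Phi> (t + a) / m)\<close>.
  The moments \<open>c powr t * Gamma (r + p t) / Gamma r\<close> of \<open>c G\<^sup>p\<close> satisfy it, with \<open>c\<close> fixed by \<open>m\<close>.

  A law on the positive half-line is determined by its moments of small positive real orders, if
  these are finite (\<open>mellin_unique\<close>): as functions of a complex order they are holomorphic in a strip, and their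
  boundary values on the imaginary axis are the characteristic function of the logarithm. This
  yields the forward implication at once.

  For the converse it remains to see that the functional equation has no other solutions among
  moment functions. On its own it only determines \<open>\<Phi>\<close> up to a factor of period \<open>a\<close>, and knowing
  \<open>\<Phi>\<close> at the multiples of \<open>a\<close> is not enough, because the corresponding moment problem can be
  indeterminate when \<open>s > 2\<close>. Positivity of the measure supplies what is missing: \<open>\<Phi>\<close> is log-convex
  by Cauchy--Schwarz. Since \<open>ln \<circ> Gamma\<close> becomes asymptotically affine on intervals of fixed length,
  log-convexity of \<open>\<Phi>\<close> passes to the periodic factor, which must therefore be constant. This is
  the Bohr--Mollerup argument, with period \<open>a\<close> in place of \<open>1\<close> (\<open>Bohr_Mollerup_with_period\<close>).
\<close>

section \<open>Uniqueness for two-sided Laplace transforms\<close>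

lemma norm_exp_minus_one_le:
  fixes w :: complex
  shows "norm (exp w - 1) \<le> norm w * exp (norm w)"
proof -
  have "norm (exp w - (\<Sum>k\<le>0. w ^ k / fact k)) \<le> exp \<bar>Re w\<bar> * norm w ^ Suc 0 / fact 0"
    by (rule Taylor_exp)
  also have "\<dots> \<le> norm w * exp (norm w)"
    using abs_Re_le_cmod[of w] by (simp add: mult.commute mult_left_mono)
  finally show ?thesis by simp
qed

text \<open>
  Differentiation under the integral sign. Near a point \<open>z\<close> of the strip the difference quotients of
  \<open>exp (z x)\<close> grow like \<open>exp (Re z x + 2 e \<bar>x\<bar>)\<close>, which the exponentials at the two abscissae
  \<open>Re z \<plusminus> 2 e\<close> dominate as long as both stay inside the strip.
\<close>
lemma holomorphic_two_sided_Laplace: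
  fixes b :: real
  assumes M: "real_distribution M"
    and int: "\<And>t. 0 < t \<Longrightarrow> t < b \<Longrightarrow> integrable M (\<lambda>x. exp (t * x))"
  shows "(\<lambda>z. CLINT x|M. exp (z * of_real x)) holomorphic_on {z. 0 < Re z \<and> Re z < b}"
proof -
  interpret real_distribution M by (rule M)
  have integ: "integrable M (\<lambda>x. exp (z * of_real x))" if "0 < Re z" "Re z < b" for z :: complex
    by (rule Bochner_Integration.integrable_bound[OF int[OF that]]) auto
  have "\<exists>D. ((\<lambda>z. CLINT x|M. exp (z * of_real x)) has_field_derivative D) (at z)"
    if z: "0 < Re z" "Re z < b" for z :: complex
  proof -
    \<comment> \<open>The factor \<open>1 / 3\<close> leaves room for \<open>Re z \<plusminus> 2 * e\<close> strictly inside the strip: one \<open>e\<close> absorbs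
      the increment \<open>h\<close>, the other the factor \<open>\<bar>x\<bar>\<close> that it brings down.\<close>
    define e where "e = min (Re z) (b - Re z) / 3"
    have e: "e > 0" "Re z - 2 * e > 0" "Re z + 2 * e < b" using z by (auto simp: e_def min_def field_simps)
    define g where "g = (\<lambda>x. (exp ((Re z + 2 * e) * x) + exp ((Re z - 2 * e) * x)) / e)"
    have g_int: "integrable M g" unfolding g_def
      using e z by (intro Bochner_Integration.integrable_divide Bochner_Integration.integrable_add int) auto
    have bound: "norm ((exp ((z + h) * of_real x) - exp (z * of_real x)) / h) \<le> g x"
      if h: "norm h \<le> e" "h \<noteq> 0" for h :: complex and x :: real
    proof -
      have "norm (exp ((z + h) * of_real x) - exp (z * of_real x)) =
          exp (Re z * x) * norm (exp (h * of_real x) - 1)"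
      proof -
        have "exp ((z + h) * of_real x) - exp (z * of_real x) =
            exp (z * of_real x) * (exp (h * of_real x) - 1)"
          by (simp add: exp_add algebra_simps)
        thus ?thesis by (simp only: norm_mult norm_exp_eq_Re) simp
      qed
      also have "\<dots> \<le> exp (Re z * x) * (norm (h * of_real x) * exp (norm (h * of_real x)))"
        by (intro mult_left_mono norm_exp_minus_one_le) auto
      also have "\<dots> \<le> exp (Re z * x) * (norm (h * of_real x) * exp (e * \<bar>x\<bar>))"
        using h by (intro mult_left_mono) (auto simp: norm_mult intro: mult_right_mono)
      finally have "norm ((exp ((z + h) * of_real x) - exp (z * of_real x)) / h)
          \<le> exp (Re z * x) * (\<bar>x\<bar> * exp (e * \<bar>x\<bar>))"
        using h by (simp add: norm_divide norm_mult divide_le_eq mult_ac)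
      also have "\<dots> \<le> exp (Re z * x) * (exp (e * \<bar>x\<bar>) / e * exp (e * \<bar>x\<bar>))"
      proof -
        have "e * \<bar>x\<bar> \<le> exp (e * \<bar>x\<bar>)" using exp_ge_add_one_self[of "e * \<bar>x\<bar>"] by linarith
        hence "\<bar>x\<bar> \<le> exp (e * \<bar>x\<bar>) / e" using e by (simp add: le_divide_eq mult.commute)
        thus ?thesis by (intro mult_left_mono mult_right_mono) auto
      qed
      also have "\<dots> = exp (Re z * x + 2 * e * \<bar>x\<bar>) / e"
        by (simp add: exp_add [symmetric] algebra_simps)
      also have "\<dots> \<le> g x"
        unfolding g_def using e by (cases "x \<ge> 0") (auto intro!: divide_right_mono simp: algebra_simps)
      finally show ?thesis .
    qed
    have "((\<lambda>h. ((CLINT x|M. exp ((z + h) * of_real x)) - (CLINT x|M. exp (z * of_real x))) / h)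
        \<longlongrightarrow> (CLINT x|M. of_real x * exp (z * of_real x))) (at 0)"
      unfolding tendsto_at_iff_sequentially comp_def
    proof (intro allI impI)
      fix h :: "nat \<Rightarrow> complex"
      assume h0: "\<forall>i. h i \<in> UNIV - {0}" and hl: "h \<longlonglongrightarrow> 0"
      have nz: "h i \<noteq> 0" for i using h0 by auto
      have "(\<lambda>i. CLINT x|M. (exp ((z + h i) * of_real x) - exp (z * of_real x)) / h i)
          \<longlonglongrightarrow> (CLINT x|M. of_real x * exp (z * of_real x))"
      proof -
        obtain i0 where i0: "\<And>i. i \<ge> i0 \<Longrightarrow> norm (h i) \<le> e"
          using LIMSEQ_D[OF hl e(1)] by (metis diff_zero less_imp_le)
        have "(\<lambda>i. CLINT x|M. (exp ((z + h (i + i0)) * of_real x) - exp (z * of_real x)) / h (i + i0))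
            \<longlonglongrightarrow> (CLINT x|M. of_real x * exp (z * of_real x))"
        proof (rule integral_dominated_convergence[OF _ _ g_int])
          show "AE x in M. norm ((exp ((z + h (i + i0)) * of_real x) - exp (z * of_real x)) / h (i + i0)) \<le> g x" for i
            using bound[OF i0 nz] by auto
          show "AE x in M. (\<lambda>i. (exp ((z + h (i + i0)) * of_real x) - exp (z * of_real x)) / h (i + i0))
              \<longlonglongrightarrow> of_real x * exp (z * of_real x)"
          proof (rule AE_I2)
            fix x :: real
            have "((\<lambda>w. exp (w * of_real x)) has_field_derivative of_real x * exp (z * of_real x)) (at z)"
              by (auto intro!: derivative_eq_intros)
            hence "((\<lambda>h. (exp ((z + h) * of_real x) - exp (z * of_real x)) / h)
                \<longlongrightarrow> of_real x * exp (z * of_real x)) (at 0)"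
              by (simp add: DERIV_def)
            hence "(\<lambda>i. (exp ((z + h i) * of_real x) - exp (z * of_real x)) / h i)
                \<longlonglongrightarrow> of_real x * exp (z * of_real x)"
              using h0 hl unfolding tendsto_at_iff_sequentially comp_def by blast
            thus "(\<lambda>i. (exp ((z + h (i + i0)) * of_real x) - exp (z * of_real x)) / h (i + i0))
                \<longlonglongrightarrow> of_real x * exp (z * of_real x)"
              by (rule LIMSEQ_ignore_initial_segment)
          qed
        qed measurable
        thus ?thesis by (rule LIMSEQ_offset)
      qed
      moreover have "eventually (\<lambda>i.
          (CLINT x|M. (exp ((z + h i) * of_real x) - exp (z * of_real x)) / h i) =
          ((CLINT x|M. exp ((z + h i) * of_real x)) - (CLINT x|M. exp (z * of_real x))) / h i) sequentially"
      proof -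
        have "(\<lambda>i. Re (z + h i)) \<longlonglongrightarrow> Re (z + 0)" by (intro tendsto_intros hl)
        hence "eventually (\<lambda>i. 0 < Re (z + h i)) sequentially" "eventually (\<lambda>i. Re (z + h i) < b) sequentially"
          using z by (auto intro: order_tendstoD)
        thus ?thesis
        proof eventually_elim
          case (elim i)
          show ?case using integ[OF elim] integ[OF z] by simp
        qed
      qed
      ultimately show "(\<lambda>i. ((CLINT x|M. exp ((z + h i) * of_real x)) - (CLINT x|M. exp (z * of_real x))) / h i)
          \<longlonglongrightarrow> (CLINT x|M. of_real x * exp (z * of_real x))"
        by (rule Lim_transform_eventually)
    qed
    thus ?thesis unfolding DERIV_def by blast
  qed
  moreover have "open {z. 0 < Re z \<and> Re z < b}"
    by (intro open_Collect_conj open_Collect_less continuous_intros)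
  ultimately show ?thesis by (subst holomorphic_on_open) auto
qed

text \<open>
  The imaginary axis is the boundary of the strip of convergence, and the characteristic function is
  the boundary value of the transform there. The abscissae \<open>b / (n + 2)\<close> decrease to zero from at most
  \<open>b / 2\<close>, so that \<open>1 + exp (b x / 2)\<close> dominates.
\<close>
lemma char_eq_lim_Laplace:
  fixes b u :: real
  assumes M: "real_distribution M" and "b > 0"
    and int: "\<And>t. 0 < t \<Longrightarrow> t < b \<Longrightarrow> integrable M (\<lambda>x. exp (t * x))"
  shows "(\<lambda>n. CLINT x|M. exp (Complex (b / (real n + 2)) u * of_real x)) \<longlonglongrightarrow> char M u"
  unfolding char_def
proof (rule integral_dominated_convergence)
  interpret real_distribution M by (rule M)
  show "(\<lambda>x. iexp (u * x)) \<in> borel_measurable M"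
    "(\<lambda>x. exp (Complex (b / (real n + 2)) u * of_real x)) \<in> borel_measurable M" for n
    by measurable
  show "integrable M (\<lambda>x. 1 + exp (b / 2 * x))"
    using \<open>b > 0\<close> by (intro Bochner_Integration.integrable_add int) auto
  show "AE x in M. norm (exp (Complex (b / (real n + 2)) u * of_real x)) \<le> 1 + exp (b / 2 * x)" for n
  proof (rule AE_I2)
    fix x :: real
    have "exp (b / (real n + 2) * x) \<le> 1 + exp (b / 2 * x)"
    proof (cases "x \<ge> 0")
      case True
      have "b / (real n + 2) * x \<le> b / 2 * x" using True \<open>b > 0\<close>
        by (intro mult_right_mono divide_left_mono) auto
      thus ?thesis by (smt (verit) exp_le_cancel_iff)
    next
      case False
      have "b / (real n + 2) * x \<le> 0" using False \<open>b > 0\<close> by (intro mult_nonneg_nonpos) auto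
      thus ?thesis by (smt (verit) exp_le_one_iff exp_gt_zero)
    qed
    thus "norm (exp (Complex (b / (real n + 2)) u * of_real x)) \<le> 1 + exp (b / 2 * x)" by simp
  qed
  show "AE x in M. (\<lambda>n. exp (Complex (b / (real n + 2)) u * of_real x)) \<longlonglongrightarrow> iexp (u * x)"
  proof (rule AE_I2)
    fix x :: real
    have "(\<lambda>n. b / (real n + 2)) \<longlonglongrightarrow> 0" by real_asymp
    hence "(\<lambda>n. exp (Complex (b / (real n + 2)) u * of_real x)) \<longlonglongrightarrow> exp (Complex 0 u * of_real x)"
      by (intro tendsto_intros)
    thus "(\<lambda>n. exp (Complex (b / (real n + 2)) u * of_real x)) \<longlonglongrightarrow> iexp (u * x)"
      by (simp add: complex_eq_iff exp_eq_polar Complex_eq mult.assoc)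
  qed
qed

text \<open>
  Equality on a real interval spreads to the whole strip by the identity theorem, reaches the
  characteristic functions in the limit, and these determine the laws.
\<close>
lemma two_sided_Laplace_unique:
  fixes b :: real
  assumes M1: "real_distribution M1" and M2: "real_distribution M2" and "b > 0"
    and int1: "\<And>t. 0 < t \<Longrightarrow> t < b \<Longrightarrow> integrable M1 (\<lambda>x. exp (t * x))"
    and int2: "\<And>t. 0 < t \<Longrightarrow> t < b \<Longrightarrow> integrable M2 (\<lambda>x. exp (t * x))"
    and eq: "\<And>t. 0 < t \<Longrightarrow> t < b \<Longrightarrow> (\<integral>x. exp (t * x) \<partial>M1) = (\<integral>x. exp (t * x) \<partial>M2)"
  shows "M1 = M2"
proof (rule Levy_uniqueness[OF M1 M2], rule ext)
  fix u :: real
  let ?S = "{z. 0 < Re z \<and> Re z < b}"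
  let ?F = "\<lambda>M z. CLINT x|M. exp (z * of_real x)"
  have F_eq: "?F M1 z = ?F M2 z" if "z \<in> ?S" for z
  proof -
    have "?F M1 z - ?F M2 z = 0"
    proof (rule analytic_continuation[where f = "\<lambda>z. ?F M1 z - ?F M2 z" and S = ?S
        and U = "of_real ` {0<..<b}" and \<xi> = "of_real (b / 2)"])
      show "(\<lambda>z. ?F M1 z - ?F M2 z) holomorphic_on ?S"
        by (intro holomorphic_on_diff holomorphic_two_sided_Laplace M1 M2 int1 int2)
      show "open ?S" by (intro open_Collect_conj open_Collect_less continuous_intros)
      have "convex ({z. Re z > 0} \<inter> {z. Re z < b})"
        by (intro convex_Int convex_halfspace_Re_gt convex_halfspace_Re_lt)
      thus "connected ?S" by (simp add: convex_connected Collect_conj_eq)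
      have "(b / 2) islimpt {0<..<b}" using \<open>b > 0\<close>
        by (intro interior_limit_point) (auto simp: interior_open)
      moreover have "eventually (\<lambda>x. complex_of_real x \<noteq> of_real (b / 2)) (at (b / 2))"
        unfolding of_real_eq_iff by (rule eventually_neq_at_within)
      ultimately show "complex_of_real (b / 2) islimpt of_real ` {0<..<b}"
        by (intro islimpt_isCont_image continuous_intros)
      fix w assume "w \<in> complex_of_real ` {0<..<b}"
      then obtain t where t: "w = of_real t" "0 < t" "t < b" by auto
      have "?F M w = of_real (\<integral>x. exp (t * x) \<partial>M)" for M
        unfolding t by (simp add: exp_of_real flip: of_real_mult)
      thus "?F M1 w - ?F M2 w = 0" using eq[OF t(2,3)] by simp
    qed (use \<open>b > 0\<close> that in auto)
    thus ?thesis by simp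
  qed
  have lim: "(\<lambda>n. ?F M1 (Complex (b / (real n + 2)) u)) \<longlonglongrightarrow> char M1 u"
    "(\<lambda>n. ?F M2 (Complex (b / (real n + 2)) u)) \<longlonglongrightarrow> char M2 u"
    by (rule char_eq_lim_Laplace[OF M1 \<open>b > 0\<close> int1] char_eq_lim_Laplace[OF M2 \<open>b > 0\<close> int2]; assumption)+
  have "?F M1 (Complex (b / (real n + 2)) u) = ?F M2 (Complex (b / (real n + 2)) u)" for n
  proof (rule F_eq)
    have "b / (real n + 2) < b / 1"
      using \<open>b > 0\<close> by (intro divide_strict_left_mono) auto
    thus "Complex (b / (real n + 2)) u \<in> ?S" using \<open>b > 0\<close> by simp
  qed
  with lim show "char M1 u = char M2 u" by (simp add: LIMSEQ_unique)
qed

section \<open>A Bohr--Mollerup theorem with an arbitrary period\<close>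

text \<open>
  Second differences of \<open>ln \<circ> Gamma\<close> are nonnegative by convexity. Convexity also traps the two
  slopes involved between the slopes on adjacent unit intervals, which the functional equation of
  \<open>Gamma\<close> makes equal to \<open>ln (y - 1)\<close> and \<open>ln (y + 2 h)\<close>; their difference vanishes at infinity.
\<close>
lemma ln_Gamma_second_difference:
  fixes h :: real
  assumes "h > 0"
  shows "((\<lambda>y. ln (Gamma y) - 2 * ln (Gamma (y + h)) + ln (Gamma (y + 2 * h))) \<longlongrightarrow> 0) at_top"
proof (rule real_tendsto_sandwich)
  define f where "f = (ln \<circ> Gamma :: real \<Rightarrow> real)"
  have f: "convex_on {0<..} f" unfolding f_def by (rule log_convex_Gamma_real)
  have step: "f (x + 1) - f x = ln x" if "x > 0" for x
  proof -
    have "x \<notin> \<int>\<^sub>\<le>\<^sub>0" using that nonpos_Ints_nonpos by fastforce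
    thus ?thesis using that by (simp add: f_def Gamma_plus1 ln_mult_pos Gamma_real_pos)
  qed
  show "eventually (\<lambda>y. 0 \<le> ln (Gamma y) - 2 * ln (Gamma (y + h)) + ln (Gamma (y + 2 * h))) at_top"
    using eventually_gt_at_top[of 1]
  proof eventually_elim
    case (elim y)
    have "(f y - f (y + h)) / (y - (y + h)) \<le> (f (y + h) - f (y + 2 * h)) / ((y + h) - (y + 2 * h))"
      using elim assms by (intro order.trans[OF convex_on_slope_le(1,2)[OF f]]) auto
    moreover have "(f y - f (y + h)) / (y - (y + h)) = (f (y + h) - f y) / h"
      "(f (y + h) - f (y + 2 * h)) / ((y + h) - (y + 2 * h)) = (f (y + 2 * h) - f (y + h)) / h"
      using assms by (simp_all add: field_simps)
    ultimately have "f (y + h) - f y \<le> f (y + 2 * h) - f (y + h)"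
      using assms by (simp add: divide_le_cancel)
    thus ?case by (simp add: f_def)
  qed
  show "eventually (\<lambda>y. ln (Gamma y) - 2 * ln (Gamma (y + h)) + ln (Gamma (y + 2 * h))
          \<le> h * (ln (y + 2 * h) - ln (y - 1))) at_top"
    using eventually_gt_at_top[of 1]
  proof eventually_elim
    case (elim y)
    have "(f (y + h) - f (y + 2 * h)) / ((y + h) - (y + 2 * h)) \<le>
        (f (y + 2 * h) - f (y + 2 * h + 1)) / ((y + 2 * h) - (y + 2 * h + 1))"
      using elim assms by (intro order.trans[OF convex_on_slope_le(1,2)[OF f]]) auto
    hence 1: "f (y + 2 * h) - f (y + h) \<le> h * ln (y + 2 * h)"
      using step[of "y + 2 * h"] elim assms by (simp add: field_simps)
    have "(f (y - 1) - f y) / ((y - 1) - y) \<le> (f y - f (y + h)) / (y - (y + h))"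
      using elim assms by (intro order.trans[OF convex_on_slope_le(1,2)[OF f]]) auto
    hence 2: "h * ln (y - 1) \<le> f (y + h) - f y"
      using step[of "y - 1"] elim assms by (simp add: field_simps)
    show ?case using 1 2 by (simp add: f_def algebra_simps)
  qed
  show "((\<lambda>y. h * (ln (y + 2 * h) - ln (y - 1))) \<longlongrightarrow> 0) at_top"
    by real_asymp
qed auto

lemma convex_bounded_sequence_antimono:
  fixes u :: "nat \<Rightarrow> real"
  assumes conv: "\<And>n. 2 * u (Suc n) \<le> u n + u (Suc (Suc n))"
    and bdd: "\<And>n. u n \<le> C"
  shows "u 1 \<le> u 0"
proof (rule ccontr)
  define d where "d = u 1 - u 0"
  assume "\<not> u 1 \<le> u 0"
  hence "d > 0" by (simp add: d_def)
  have slope: "d \<le> u (Suc n) - u n" for n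
  proof (induction n)
    case (Suc n)
    thus ?case using conv[of n] by simp
  qed (simp add: d_def)
  have growth: "u 0 + real n * d \<le> u n" for n
  proof (induction n)
    case (Suc n)
    thus ?case using slope[of n] by (simp add: algebra_simps)
  qed simp
  obtain n :: nat where "real n * d > C - u 0"
    using reals_Archimedean3[OF \<open>d > 0\<close>] by blast
  thus False using growth[of n] bdd[of n] by linarith
qed

text \<open>
  By periodicity a second difference at \<open>t\<close> equals the one at \<open>t + n a\<close>, so a lower bound that tends
  to zero at infinity gives exact midpoint convexity everywhere. Along an arithmetic progression
  \<open>k\<close> is then a convex sequence that is bounded above, hence it cannot increase; and a periodic
  function that never increases is constant.
\<close>
lemma periodic_asymptotically_convex_const:
  fixes k :: "real \<Rightarrow> real"
  assumes "a > 0"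
    and per: "\<And>t. t \<ge> 0 \<Longrightarrow> k (t + a) = k t"
    and bdd: "\<And>t. 0 \<le> t \<Longrightarrow> t \<le> a \<Longrightarrow> k t \<le> C"
    and conv: "\<And>h t. h > 0 \<Longrightarrow> t \<ge> 0 \<Longrightarrow> - e h t \<le> k t - 2 * k (t + h) + k (t + 2 * h)"
    and lim: "\<And>h. h > 0 \<Longrightarrow> (e h \<longlongrightarrow> 0) at_top"
    and "t \<ge> 0"
  shows "k t = k 0"
proof -
  have per_n: "k (t + real n * a) = k t" if "t \<ge> 0" for t n
  proof (induction n)
    case (Suc n)
    have "k (t + real (Suc n) * a) = k ((t + real n * a) + a)" by (simp add: algebra_simps)
    also have "\<dots> = k t" using per[of "t + real n * a"] Suc that \<open>a > 0\<close> by simp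
    finally show ?case .
  qed simp
  have bdd': "k t \<le> C" if "t \<ge> 0" for t
  proof -
    define n where "n = nat \<lfloor>t / a\<rfloor>"
    have n: "real n \<le> t / a" "t / a < real n + 1"
      using that \<open>a > 0\<close> by (auto simp: n_def)
    hence "0 \<le> t - real n * a" "t - real n * a \<le> a"
      using \<open>a > 0\<close> by (auto simp: field_simps)
    thus ?thesis using bdd[of "t - real n * a"] per_n[of "t - real n * a" n] by simp
  qed
  have conv': "2 * k (t + h) \<le> k t + k (t + 2 * h)" if "t \<ge> 0" "h > 0" for t h
  proof -
    have at_top: "filterlim (\<lambda>n. t + real n * a) at_top sequentially"
      using \<open>a > 0\<close> by real_asymp
    have "- e h (t + real n * a) \<le> k t - 2 * k (t + h) + k (t + 2 * h)" for n
      using conv[of h "t + real n * a"] per_n[of t n] per_n[of "t + h" n] per_n[of "t + 2 * h" n]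
        that \<open>a > 0\<close> by (simp add: algebra_simps)
    moreover have "(\<lambda>n. - e h (t + real n * a)) \<longlonglongrightarrow> - 0"
      by (intro tendsto_minus filterlim_compose[OF lim at_top] that)
    ultimately have "- 0 \<le> k t - 2 * k (t + h) + k (t + 2 * h)"
      by (intro LIMSEQ_le_const2) auto
    thus ?thesis by simp
  qed
  have mono: "k (t + h) \<le> k t" if "t \<ge> 0" "h > 0" for t h
  proof -
    have "k (t + real 1 * h) \<le> k (t + real 0 * h)"
    proof (rule convex_bounded_sequence_antimono)
      fix n
      show "2 * k (t + real (Suc n) * h) \<le> k (t + real n * h) + k (t + real (Suc (Suc n)) * h)"
        using conv'[of "t + real n * h" h] that by (simp add: algebra_simps)
      show "k (t + real n * h) \<le> C" using that by (intro bdd') auto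
    qed
    thus ?thesis by simp
  qed
  show ?thesis
  proof (cases "t = 0")
    case False
    \<comment> \<open>At the first multiple of the period beyond \<open>t\<close> the value \<open>k 0\<close> recurs.\<close>
    define n where "n = Suc (nat \<lfloor>t / a\<rfloor>)"
    have "t / a < real n" by (simp add: n_def) linarith
    hence "t < real n * a" using \<open>a > 0\<close> by (simp add: field_simps)
    hence "k (0 + real n * a) \<le> k t" using mono[of t "real n * a - t"] \<open>t \<ge> 0\<close> by simp
    hence "k 0 \<le> k t" using per_n[of 0 n] by simp
    moreover have "k t \<le> k 0" using mono[of 0 t] False \<open>t \<ge> 0\<close> by simp
    ultimately show ?thesis by simp
  qed simp
qed

text \<open>
  The quotient of \<open>\<phi>\<close> and \<open>K powr (t / a) * Gamma (r + p t)\<close> has period \<open>a\<close>. Its logarithm need not be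
  convex, but it misses convexity by at most the second difference of \<open>ln \<circ> Gamma\<close>, which dies out. The
  classical theorem is the case \<open>a = p = r = K = 1\<close>.
\<close>
lemma Bohr_Mollerup_with_period:
  fixes \<phi> :: "real \<Rightarrow> real" and a p r K C :: real
  assumes "a > 0" "p > 0" "r > 0" "K > 0"
    and pos: "\<And>t. t \<ge> 0 \<Longrightarrow> \<phi> t > 0"
    and log_convex: "\<And>t h. t \<ge> 0 \<Longrightarrow> h > 0 \<Longrightarrow> (\<phi> (t + h))\<^sup>2 \<le> \<phi> t * \<phi> (t + 2 * h)"
    and bdd: "\<And>t. 0 \<le> t \<Longrightarrow> t \<le> a \<Longrightarrow> \<phi> t \<le> C"
    and fe: "\<And>t. t \<ge> 0 \<Longrightarrow> \<phi> (t + a) = K * \<phi> t * (Gamma (r + p * (t + a)) / Gamma (r + p * t))"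
    and "\<phi> 0 = 1"
  obtains c where "c > 0" "\<And>t. t \<ge> 0 \<Longrightarrow> \<phi> t = c powr t * (Gamma (r + p * t) / Gamma r)"
proof -
  define g where "g = (\<lambda>t. ln (Gamma (r + p * t)))"
  \<comment> \<open>The linear term removes the constant \<open>ln K\<close> gained over each period.\<close>
  define k where "k = (\<lambda>t. ln (\<phi> t) - g t - ln K / a * t)"
  have Gpos: "Gamma (r + p * t) > 0" if "t \<ge> 0" for t
    using assms that by (intro Gamma_real_pos add_pos_nonneg) auto
  have "continuous_on {0..a} g"
    unfolding g_def
  proof (intro continuous_at_imp_continuous_on ballI)
    fix t assume "t \<in> {0..a}"
    hence t: "t \<ge> 0" by simp
    have "r + p * t > 0" using t assms by (intro add_pos_nonneg) auto
    hence "r + p * t \<notin> \<int>\<^sub>\<le>\<^sub>0" using nonpos_Ints_nonpos by fastforce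
    moreover have "Gamma (r + p * t) \<noteq> 0" using Gpos[OF t] by simp
    ultimately show "isCont (\<lambda>t. ln (Gamma (r + p * t))) t"
      by (intro isCont_ln isCont_Gamma continuous_intros)
  qed
  hence "bounded (g ` {0..a})"
    by (intro compact_imp_bounded compact_continuous_image) auto
  then obtain D where D: "\<And>t. 0 \<le> t \<Longrightarrow> t \<le> a \<Longrightarrow> \<bar>g t\<bar> \<le> D"
    unfolding bounded_iff by (metis atLeastAtMost_iff imageI real_norm_def)
  have const: "k t = k 0" if "t \<ge> 0" for t
  proof (rule periodic_asymptotically_convex_const[OF \<open>a > 0\<close>])
    fix t assume t: "t \<ge> (0 :: real)"
    have "ln (\<phi> (t + a)) = ln K + ln (\<phi> t) + (g (t + a) - g t)"
      unfolding fe[OF t] g_def using pos[OF t] Gpos[OF t] Gpos[of "t + a"] t \<open>a > 0\<close> \<open>K > 0\<close>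
      by (simp add: ln_mult_pos ln_divide_pos)
    moreover have "ln K / a * (t + a) = ln K / a * t + ln K" using \<open>a > 0\<close> by (simp add: field_simps)
    ultimately show "k (t + a) = k t" by (simp add: k_def)
  next
    fix t assume t: "0 \<le> t" "t \<le> a"
    have "ln (\<phi> t) \<le> ln C" using bdd[OF t] pos[OF t(1)] by simp
    moreover have "- (ln K / a * t) \<le> \<bar>ln K\<bar>"
    proof -
      have "- ln K * (t / a) \<le> \<bar>ln K\<bar> * (t / a)"
        using t \<open>a > 0\<close> by (intro mult_right_mono) auto
      hence "- (ln K / a * t) \<le> \<bar>ln K\<bar> * (t / a)" by simp
      also have "\<dots> \<le> \<bar>ln K\<bar> * 1" using t \<open>a > 0\<close> by (intro mult_left_mono) auto
      finally show ?thesis by simp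
    qed
    ultimately show "k t \<le> ln C + D + \<bar>ln K\<bar>" using D[OF t] by (simp add: k_def)
  next
    fix h t :: real assume ht: "h > 0" "t \<ge> 0"
    have "ln ((\<phi> (t + h))\<^sup>2) \<le> ln (\<phi> t * \<phi> (t + 2 * h))"
      using log_convex[OF ht(2,1)] pos[of "t + h"] ht by (subst ln_le_cancel_iff) (auto intro!: mult_pos_pos pos)
    hence "2 * ln (\<phi> (t + h)) \<le> ln (\<phi> t) + ln (\<phi> (t + 2 * h))"
      using pos[of "t + h"] pos[of t] pos[of "t + 2 * h"] ht by (simp add: ln_mult_pos power2_eq_square)
    thus "- (g t - 2 * g (t + h) + g (t + 2 * h)) \<le> k t - 2 * k (t + h) + k (t + 2 * h)"
      by (simp add: k_def distrib_left add_divide_distrib)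
  next
    fix h :: real assume h: "h > 0"
    have "filterlim (\<lambda>t. r + p * t) at_top at_top" using \<open>p > 0\<close> by real_asymp
    from filterlim_compose[OF ln_Gamma_second_difference[of "p * h"] this] h \<open>p > 0\<close>
    show "((\<lambda>t. g t - 2 * g (t + h) + g (t + 2 * h)) \<longlongrightarrow> 0) at_top"
      by (simp add: g_def algebra_simps)
  qed (use that in auto)
  show ?thesis
  proof (rule that[of "exp (ln K / a)"])
    fix t :: real assume t: "t \<ge> 0"
    have "ln (\<phi> t) = ln K / a * t + g t - g 0"
      using const[OF t] \<open>\<phi> 0 = 1\<close> by (simp add: k_def)
    hence "\<phi> t = exp (ln K / a * t + g t - g 0)" using pos[OF t] by (metis exp_ln)
    also have "\<dots> = exp (ln K / a) powr t * (Gamma (r + p * t) / Gamma r)"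
      using Gpos[OF t] Gpos[of 0] by (simp add: g_def exp_diff exp_add powr_def mult.commute)
    finally show "\<phi> t = exp (ln K / a) powr t * (Gamma (r + p * t) / Gamma r)" .
  qed auto
qed

section \<open>Mellin transforms of laws on the half-line\<close>

text \<open>
  Extended nonnegative values let identities between moments be stated before their finiteness is
  known. With the convention \<open>0 powr t = 0\<close> an atom at zero is invisible, even for \<open>t = 0\<close>.
\<close>
definition mellin :: "real measure \<Rightarrow> real \<Rightarrow> ennreal" where
  "mellin \<mu> t = (\<integral>\<^sup>+x. ennreal (x powr t) \<partial>\<mu>)"

text \<open>
  The Mellin transform of a law on the positive half-line is the two-sided Laplace transform of the
  law of the logarithm.
\<close>
lemma mellin_unique:
  assumes \<mu>: "prob_space \<mu>" "sets \<mu> = sets borel" "AE x in \<mu>. x > 0"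
    and \<nu>: "prob_space \<nu>" "sets \<nu> = sets borel" "AE x in \<nu>. x > 0"
    and "b > 0"
    and fin: "\<And>t. 0 < t \<Longrightarrow> t < b \<Longrightarrow> mellin \<mu> t < \<infinity>"
    and eq: "\<And>t. 0 < t \<Longrightarrow> t < b \<Longrightarrow> mellin \<mu> t = mellin \<nu> t"
  shows "\<mu> = \<nu>"
proof -
  have dist: "real_distribution (distr \<kappa> borel ln)"
    if "prob_space \<kappa>" and [measurable_cong]: "sets \<kappa> = sets borel" for \<kappa>
  proof -
    have "prob_space (distr \<kappa> borel ln)" by (intro prob_space.prob_space_distr that(1)) measurable
    thus ?thesis by (simp add: real_distribution_def real_distribution_axioms_def)
  qed
  have exp_ln: "(\<integral>\<^sup>+x. ennreal (exp (t * x)) \<partial>distr \<kappa> borel ln) = mellin \<kappa> t"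
    if [measurable_cong]: "sets \<kappa> = sets borel" and "AE x in \<kappa>. x > 0" for \<kappa> t
  proof -
    have "(\<integral>\<^sup>+x. ennreal (exp (t * x)) \<partial>distr \<kappa> borel ln) = (\<integral>\<^sup>+x. ennreal (exp (t * ln x)) \<partial>\<kappa>)"
      by (rule nn_integral_distr) measurable
    also have "\<dots> = mellin \<kappa> t" unfolding mellin_def
      using that(2) by (intro nn_integral_cong_AE) (auto simp: powr_def)
    finally show ?thesis .
  qed
  have "distr \<mu> borel ln = distr \<nu> borel ln"
  proof (rule two_sided_Laplace_unique[OF dist[OF \<mu>(1,2)] dist[OF \<nu>(1,2)] \<open>b > 0\<close>])
    fix t assume t: "0 < t" "t < b"
    show "integrable (distr \<mu> borel ln) (\<lambda>x. exp (t * x))"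
      using fin[OF t] exp_ln[OF \<mu>(2,3), of t] by (intro integrableI_nonneg) auto
    show "integrable (distr \<nu> borel ln) (\<lambda>x. exp (t * x))"
      using fin[OF t] eq[OF t] exp_ln[OF \<nu>(2,3), of t] by (intro integrableI_nonneg) auto
    show "(\<integral>x. exp (t * x) \<partial>distr \<mu> borel ln) = (\<integral>x. exp (t * x) \<partial>distr \<nu> borel ln)"
      using eq[OF t] exp_ln[OF \<mu>(2,3), of t] exp_ln[OF \<nu>(2,3), of t]
      by (simp add: integral_eq_nn_integral)
  qed
  hence "distr (distr \<mu> borel ln) borel exp = distr (distr \<nu> borel ln) borel exp" by simp
  moreover have "distr (distr \<kappa> borel ln) borel exp = \<kappa>"
    if [measurable_cong]: "sets \<kappa> = sets borel" and "AE x in \<kappa>. x > 0" for \<kappa> :: "real measure"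
  proof -
    have "distr (distr \<kappa> borel ln) borel exp = distr \<kappa> borel (\<lambda>x. exp (ln x))"
      by (subst distr_distr) (simp_all add: comp_def)
    also have "\<dots> = distr \<kappa> borel (\<lambda>x. x)"
      using that(2) by (intro distr_cong_AE) auto
    also have "\<dots> = \<kappa>" using that(1) by (intro distr_id2) simp
    finally show ?thesis .
  qed
  ultimately show ?thesis using \<mu>(2,3) \<nu>(2,3) by simp
qed

text \<open>
  The Cauchy--Schwarz inequality for \<open>x powr (t / 2)\<close> and \<open>x powr (t / 2 + h)\<close>.
\<close>
lemma mellin_log_convex:
  assumes [measurable_cong]: "sets \<mu> = sets borel"
  shows "(mellin \<mu> (t + h))\<^sup>2 \<le> mellin \<mu> t * mellin \<mu> (t + 2 * h)"
proof -
  have "(\<integral>\<^sup>+x. ennreal (x powr (t / 2)) * ennreal (x powr (t / 2 + h)) \<partial>\<mu>)\<^sup>2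
      \<le> (\<integral>\<^sup>+x. (ennreal (x powr (t / 2)))\<^sup>2 \<partial>\<mu>) * (\<integral>\<^sup>+x. (ennreal (x powr (t / 2 + h)))\<^sup>2 \<partial>\<mu>)"
    by (rule Cauchy_Schwarz_nn_integral) measurable
  moreover have "ennreal (x powr (t / 2)) * ennreal (x powr (t / 2 + h)) = ennreal (x powr (t + h))"
    "(ennreal (x powr (t / 2)))\<^sup>2 = ennreal (x powr t)"
    "(ennreal (x powr (t / 2 + h)))\<^sup>2 = ennreal (x powr (t + 2 * h))" for x
    by (simp_all add: ennreal_power ennreal_mult' [symmetric] power2_eq_square powr_add [symmetric] add.assoc)
  ultimately show ?thesis unfolding mellin_def by simp
qed

lemma mellin_distr:
  assumes [measurable]: "X \<in> borel_measurable M"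
  shows "mellin (distr M borel X) t = (\<integral>\<^sup>+\<omega>. ennreal (X \<omega> powr t) \<partial>M)"
  unfolding mellin_def by (rule nn_integral_distr) auto

lemma mellin_scale_powr:
  fixes c p t :: real
  assumes [measurable]: "X \<in> borel_measurable M"
  shows "mellin (distr M borel (\<lambda>\<omega>. c * X \<omega> powr p)) t = ennreal (c powr t) * mellin (distr M borel X) (p * t)"
proof -
  have "mellin (distr M borel (\<lambda>\<omega>. c * X \<omega> powr p)) t =
      (\<integral>\<^sup>+\<omega>. ennreal (c powr t) * ennreal (X \<omega> powr (p * t)) \<partial>M)"
    by (subst mellin_distr) (auto simp: powr_mult powr_powr ennreal_mult' intro!: nn_integral_cong)
  thus ?thesis by (simp add: nn_integral_cmult mellin_distr)
qed

lemma (in prob_space) mellin_indep_product: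
  fixes X Y :: "'a \<Rightarrow> real"
  assumes ind: "indep_var borel X borel Y"
  shows "mellin (distr M borel (\<lambda>\<omega>. X \<omega> powr p * Y \<omega>)) t =
      mellin (distr M borel X) (p * t) * mellin (distr M borel Y) t"
proof -
  have [measurable]: "X \<in> borel_measurable M" "Y \<in> borel_measurable M"
    using ind by (auto dest: indep_var_rv1 indep_var_rv2)
  interpret Y: prob_space "distr M borel Y" by (rule prob_space_distr) simp
  have "mellin (distr M borel (\<lambda>\<omega>. X \<omega> powr p * Y \<omega>)) t =
      (\<integral>\<^sup>+\<omega>. (\<lambda>(x, y). ennreal (x powr (p * t)) * ennreal (y powr t)) (X \<omega>, Y \<omega>) \<partial>M)"
    by (subst mellin_distr) (auto simp: powr_mult powr_powr ennreal_mult' intro!: nn_integral_cong)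
  also have "\<dots> = (\<integral>\<^sup>+z. (\<lambda>(x, y). ennreal (x powr (p * t)) * ennreal (y powr t)) z
      \<partial>distr M (borel \<Otimes>\<^sub>M borel) (\<lambda>\<omega>. (X \<omega>, Y \<omega>)))"
    by (rule nn_integral_distr [symmetric]) measurable
  also have "\<dots> = (\<integral>\<^sup>+z. (\<lambda>(x, y). ennreal (x powr (p * t)) * ennreal (y powr t)) z
      \<partial>(distr M borel X \<Otimes>\<^sub>M distr M borel Y))"
    using ind by (simp add: indep_var_distribution_eq)
  also have "\<dots> = (\<integral>\<^sup>+x. \<integral>\<^sup>+y. ennreal (x powr (p * t)) * ennreal (y powr t)
      \<partial>distr M borel Y \<partial>distr M borel X)"
    by (subst Y.nn_integral_fst [symmetric]) (auto simp: split_beta')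
  also have "\<dots> = mellin (distr M borel X) (p * t) * mellin (distr M borel Y) t"
    by (simp add: nn_integral_cmult nn_integral_multc mellin_def)
  finally show ?thesis .
qed

lemma abs_powr: "\<bar>x\<bar> powr a = x powr a" for x a :: real
  by (simp add: abs_if uminus_powr_eq)

section \<open>Power bias, gamma and beta laws\<close>

text \<open>
  Biasing shifts the argument of the Mellin transform; this is what turns the distributional
  identity into a functional equation.
\<close>
lemma mellin_power_bias:
  fixes m :: real
  assumes [measurable_cong]: "sets \<mu> = sets borel"
    and "m = (\<integral>y. \<bar>y\<bar> powr a \<partial>\<mu>)" "m > 0"
  shows "mellin (power_bias a \<mu>) t = mellin \<mu> (t + a) / ennreal m"
proof -
  have m_eq: "m = (\<integral>y. y powr a \<partial>\<mu>)" using assms(2) by (simp add: abs_powr)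
  have "mellin (power_bias a \<mu>) t = (\<integral>\<^sup>+x. ennreal (x powr a / m) * ennreal (x powr t) \<partial>\<mu>)"
    unfolding mellin_def power_bias_def abs_powr m_eq [symmetric]
    by (subst nn_integral_density) auto
  also have "\<dots> = (\<integral>\<^sup>+x. ennreal (x powr (t + a)) / ennreal m \<partial>\<mu>)"
  proof (intro nn_integral_cong)
    fix x
    have "x powr a / m * x powr t = x powr (t + a) / m" by (simp add: powr_add)
    thus "ennreal (x powr a / m) * ennreal (x powr t) = ennreal (x powr (t + a)) / ennreal m"
      using \<open>m > 0\<close> by (simp add: divide_ennreal ennreal_mult' [symmetric])
  qed
  also have "\<dots> = mellin \<mu> (t + a) / ennreal m"
    unfolding mellin_def by (rule nn_integral_divide) measurable
  finally show ?thesis .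
qed

text \<open>
  The bias puts weight zero on the origin, so an identity of the form \<open>W = B powr p * V\<close> in law, with
  \<open>V\<close> biased and \<open>B\<close> positive, rules out an atom of \<open>W\<close> at zero.
\<close>
lemma AE_power_bias_nonzero:
  assumes [measurable_cong]: "sets \<mu> = sets borel"
  shows "AE x in power_bias a \<mu>. x \<noteq> 0"
  unfolding power_bias_def by (subst AE_density) auto

lemma mellin_gamma:
  assumes X: "distributed M lborel X (\<lambda>x. ennreal (gamma_density r x))" and "r > 0" "r + u > 0"
  shows "mellin (distr M borel X) u = ennreal (Gamma (r + u) / Gamma r)"
proof -
  have [measurable]: "X \<in> borel_measurable M" using distributed_measurable[OF X] by simp
  have "mellin (distr M borel X) u = (\<integral>\<^sup>+x. ennreal (gamma_density r x) * ennreal (x powr u) \<partial>lborel)"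
    by (subst mellin_distr, simp, rule distributed_nn_integral[OF X, symmetric]) measurable
  also have "\<dots> = (\<integral>\<^sup>+x. ennreal (indicator {0..} x * x powr (r + u - 1) / exp x) / ennreal (Gamma r) \<partial>lborel)"
  proof (intro nn_integral_cong)
    fix x
    have "x powr (r + u - 1) = x powr (r - 1) * x powr u"
      by (simp add: powr_add [symmetric] algebra_simps)
    hence "gamma_density r x * x powr u = indicator {0..} x * x powr (r + u - 1) / exp x / Gamma r"
      by (simp add: gamma_density_def indicator_def exp_minus divide_inverse)
    thus "ennreal (gamma_density r x) * ennreal (x powr u) =
        ennreal (indicator {0..} x * x powr (r + u - 1) / exp x) / ennreal (Gamma r)"
      using \<open>r > 0\<close> by (simp add: divide_ennreal Gamma_real_pos indicator_def ennreal_mult'' [symmetric])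
  qed
  also have "\<dots> = (\<integral>\<^sup>+x. ennreal (indicator {0..} x * x powr (r + u - 1) / exp x) \<partial>lborel) / ennreal (Gamma r)"
    by (rule nn_integral_divide) measurable
  also have "\<dots> = ennreal (Gamma (r + u) / Gamma r)"
    using assms by (simp add: divide_ennreal Gamma_real_pos flip: Gamma_conv_nn_integral_real)
  finally show ?thesis .
qed

lemma mellin_beta:
  assumes X: "distributed M lborel X (\<lambda>x. ennreal (beta_density r s x))" and "r > 0" "s > 0" "r + u > 0"
  shows "mellin (distr M borel X) u =
      ennreal (Gamma (r + u) * Gamma (r + s) / (Gamma r * Gamma (r + u + s)))"
proof -
  have [measurable]: "X \<in> borel_measurable M" using distributed_measurable[OF X] by simp
  define C where "C = Gamma (r + s) / (Gamma r * Gamma s)"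
  have "C > 0" using assms by (simp add: C_def Gamma_real_pos)
  have "mellin (distr M borel X) u = (\<integral>\<^sup>+x. ennreal (beta_density r s x) * ennreal (x powr u) \<partial>lborel)"
    by (subst mellin_distr, simp, rule distributed_nn_integral[OF X, symmetric]) measurable
  also have "\<dots> = (\<integral>\<^sup>+x. ennreal C * ennreal (indicator {0..1} x * (x powr (r + u - 1) * (1 - x) powr (s - 1))) \<partial>lborel)"
  proof (intro nn_integral_cong)
    fix x
    have "x powr (r + u - 1) = x powr (r - 1) * x powr u"
      by (simp add: powr_add [symmetric] algebra_simps)
    hence "beta_density r s x * x powr u =
        C * (indicator {0..1} x * (x powr (r + u - 1) * (1 - x) powr (s - 1)))"
      by (auto simp: beta_density_def indicator_def C_def)
    thus "ennreal (beta_density r s x) * ennreal (x powr u) =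
        ennreal C * ennreal (indicator {0..1} x * (x powr (r + u - 1) * (1 - x) powr (s - 1)))"
      using \<open>C > 0\<close> by (simp only: ennreal_mult' [symmetric] ennreal_mult'' [symmetric] powr_ge_zero less_imp_le)
  qed
  also have "\<dots> = ennreal C * (\<integral>\<^sup>+x. ennreal (indicator {0..1} x * (x powr (r + u - 1) * (1 - x) powr (s - 1))) \<partial>lborel)"
    by (rule nn_integral_cmult) measurable
  also have "\<dots> = ennreal C * ennreal (Beta (r + u) s)"
    using assms by (subst nn_integral_has_integral_lebesgue[OF _ has_integral_Beta_real]) auto
  also have "\<dots> = ennreal (Gamma (r + u) * Gamma (r + s) / (Gamma r * Gamma (r + u + s)))"
  proof -
    have "Gamma s > 0" using assms by (simp add: Gamma_real_pos)
    hence "C * Beta (r + u) s = Gamma (r + u) * Gamma (r + s) / (Gamma r * Gamma (r + u + s))"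
      by (simp add: C_def Beta_def)
    thus ?thesis using \<open>C > 0\<close> by (simp add: ennreal_mult' [symmetric])
  qed
  finally show ?thesis .
qed


lemma (in prob_space) AE_distr_gamma_power_pos:
  assumes X: "distributed M lborel X (\<lambda>x. ennreal (gamma_density r x))" and "c > 0"
  shows "AE x in distr M borel (\<lambda>\<omega>. c * X \<omega> powr p). x > 0"
proof -
  have [measurable]: "X \<in> borel_measurable M" using distributed_measurable[OF X] by simp
  have "AE \<omega> in M. X \<omega> > 0"
    by (subst distributed_AE2[OF X]) (auto simp: gamma_density_def)
  thus ?thesis using \<open>c > 0\<close> by (subst AE_distr_iff) auto
qed

lemma mellin_gamma_power:
  assumes X: "distributed M lborel X (\<lambda>x. ennreal (gamma_density r x))" and "r > 0" "r + p * t > 0"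
  shows "mellin (distr M borel (\<lambda>\<omega>. c * X \<omega> powr p)) t = ennreal (c powr t * (Gamma (r + p * t) / Gamma r))"
proof -
  have "X \<in> borel_measurable M" using distributed_measurable[OF X] by simp
  thus ?thesis using mellin_gamma[OF X assms(2,3)]
    by (simp add: mellin_scale_powr ennreal_mult' del: times_divide_eq_right)
qed

section \<open>The characterization\<close>

text \<open>
  The recurrence is the distributional fixed-point equation read off at the level of moments. It
  propagates finiteness from \<open>[0, s / p]\<close> to all nonnegative orders, after which the real function
  \<open>\<phi>\<close> of moments satisfies the functional equation of \<open>t \<mapsto> Gamma (r + p t)\<close> with step \<open>s / p\<close>, up to a
  constant factor, and is
  log-convex, as moments always are.
\<close>
lemma mellin_recurrence_solution:
  fixes m p r s :: real
  assumes "prob_space \<mu>" and [measurable_cong]: "sets \<mu> = sets borel" and pos: "AE x in \<mu>. x > 0"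
    and "p > 0" "r > 0" "s > 0" "m > 0"
    and fin: "mellin \<mu> (s / p) < \<infinity>"
    and rec: "\<And>t. t \<ge> 0 \<Longrightarrow> mellin \<mu> t =
      ennreal (Gamma (r + p * t) * Gamma (r + s) / (Gamma r * Gamma (r + p * t + s))) *
      (mellin \<mu> (t + s / p) / ennreal m)"
  obtains c where "c > 0"
    "\<And>t. t \<ge> 0 \<Longrightarrow> mellin \<mu> t = ennreal (c powr t * (Gamma (r + p * t) / Gamma r))"
proof -
  interpret prob_space \<mu> by fact
  define a where "a = s / p"
  have "a > 0" using \<open>p > 0\<close> \<open>s > 0\<close> by (simp add: a_def)
  define R where "R = (\<lambda>t. Gamma (r + p * t) * Gamma (r + s) / (Gamma r * Gamma (r + p * t + s)))"
  have Gpos: "Gamma r > 0" "Gamma (r + s) > 0"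
    and Gpos': "\<And>t. t \<ge> 0 \<Longrightarrow> Gamma (r + p * t) > 0" "\<And>t. t \<ge> 0 \<Longrightarrow> Gamma (r + p * t + s) > 0"
  proof -
    have "r + p * t > 0" if "t \<ge> 0" for t using \<open>p > 0\<close> \<open>r > 0\<close> that by (intro add_pos_nonneg) auto
    thus "\<And>t. t \<ge> 0 \<Longrightarrow> Gamma (r + p * t) > 0" "\<And>t. t \<ge> 0 \<Longrightarrow> Gamma (r + p * t + s) > 0"
      "Gamma r > 0" "Gamma (r + s) > 0"
      using \<open>r > 0\<close> \<open>s > 0\<close> by (auto intro!: Gamma_real_pos simp: add_pos_pos)
  qed
  have Rpos: "R t > 0" if "t \<ge> 0" for t
    using Gpos Gpos'[OF that] by (simp add: R_def)
  have rec': "mellin \<mu> t = ennreal (R t) * (mellin \<mu> (t + a) / ennreal m)" if "t \<ge> 0" for t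
    using rec[OF that] by (simp add: R_def a_def)
  have zero: "mellin \<mu> 0 = 1"
  proof -
    have "mellin \<mu> 0 = (\<integral>\<^sup>+x. 1 \<partial>\<mu>)" unfolding mellin_def
      using pos by (intro nn_integral_cong_AE) auto
    thus ?thesis by (simp add: emeasure_space_1)
  qed
  have le: "mellin \<mu> t \<le> 1 + mellin \<mu> a" if "0 \<le> t" "t \<le> a" for t
  proof -
    have "x powr t \<le> 1 + x powr a" if "x > 0" for x :: real
    proof (cases "x \<le> 1")
      case True
      hence "x powr t \<le> 1" using that \<open>0 \<le> t\<close> by (simp add: powr_le1)
      thus ?thesis by (smt (verit) powr_ge_zero)
    next
      case False
      hence "x powr t \<le> x powr a" using \<open>t \<le> a\<close> by simp
      thus ?thesis by simp
    qed
    note pointwise = this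
    have "mellin \<mu> t \<le> (\<integral>\<^sup>+x. 1 + ennreal (x powr a) \<partial>\<mu>)" unfolding mellin_def
    proof (rule nn_integral_mono_AE, use pos in eventually_elim)
      fix x :: real assume "x > 0"
      hence "ennreal (x powr t) \<le> ennreal (1 + x powr a)" by (intro ennreal_leI pointwise)
      thus "ennreal (x powr t) \<le> 1 + ennreal (x powr a)" by simp
    qed
    also have "\<dots> = 1 + mellin \<mu> a"
      by (simp add: nn_integral_add mellin_def emeasure_space_1)
    finally show ?thesis .
  qed
  \<comment> \<open>Orders up to \<open>a\<close> interpolate between the orders \<open>0\<close> and \<open>a\<close>.\<close>
  have base: "mellin \<mu> t < \<infinity>" if "0 \<le> t" "t \<le> a" for t
    using fin by (intro le_less_trans[OF le[OF that]]) (simp add: a_def less_top)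
  have finite: "mellin \<mu> t < \<infinity>" if "t \<ge> 0" for t
  proof -
    have "\<forall>t. 0 \<le> t \<and> t \<le> real (Suc n) * a \<longrightarrow> mellin \<mu> t < \<infinity>" for n
    proof (induction n)
      case 0
      show ?case using base by auto
    next
      case (Suc n)
      show ?case
      proof (intro allI impI)
        fix t assume t: "0 \<le> t \<and> t \<le> real (Suc (Suc n)) * a"
        show "mellin \<mu> t < \<infinity>"
        proof (cases "t \<le> a")
          case True
          thus ?thesis using base t by blast
        next
          case False
          hence "0 \<le> t - a \<and> t - a \<le> real (Suc n) * a" using t by (simp add: algebra_simps)
          hence "mellin \<mu> (t - a) < \<infinity>" using Suc by blast
          hence "ennreal (R (t - a)) * (mellin \<mu> t / ennreal m) < \<infinity>"
            using rec'[of "t - a"] False by simp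
          hence "mellin \<mu> t / ennreal m < \<infinity>"
            using Rpos[of "t - a"] False by (auto simp: ennreal_mult_less_top)
          thus ?thesis
            using ennreal_divide_eq_top_iff[of "mellin \<mu> t" "ennreal m"] by (auto simp: less_top)
        qed
      qed
    qed
    moreover obtain n where "t < real n * a"
      using reals_Archimedean3[OF \<open>a > 0\<close>] by blast
    hence "t \<le> real (Suc n) * a" using \<open>a > 0\<close> by (simp add: algebra_simps)
    ultimately show ?thesis using that by blast
  qed
  define \<phi> where "\<phi> = (\<lambda>t. enn2real (mellin \<mu> t))"
  have mellin_eq: "mellin \<mu> t = ennreal (\<phi> t)" if "t \<ge> 0" for t
    using finite[OF that] by (simp add: \<phi>_def less_top)
  have \<phi>_nonneg: "\<phi> t \<ge> 0" for t by (simp add: \<phi>_def)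
  have \<phi>_pos: "\<phi> t > 0" if "t \<ge> 0" for t
  proof -
    have "mellin \<mu> t \<noteq> 0"
    proof
      assume "mellin \<mu> t = 0"
      hence "AE x in \<mu>. ennreal (x powr t) = 0"
        unfolding mellin_def by (subst (asm) nn_integral_0_iff_AE) auto
      hence "AE x in \<mu>. False" using pos by eventually_elim auto
      thus False by simp
    qed
    thus ?thesis using mellin_eq[OF that] \<phi>_nonneg[of t] by (auto simp: less_le)
  qed
  have fe: "\<phi> (t + a) = m * Gamma r / Gamma (r + s) * \<phi> t * (Gamma (r + p * (t + a)) / Gamma (r + p * t))"
    if t: "t \<ge> 0" for t
  proof -
    have "ennreal (\<phi> t) = ennreal (R t * (\<phi> (t + a) / m))"
      using rec'[OF t] mellin_eq[of t] mellin_eq[of "t + a"] t \<open>a > 0\<close> \<open>m > 0\<close> Rpos[OF t]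
      by (simp add: divide_ennreal \<phi>_nonneg ennreal_mult' del: times_divide_eq_right)
    hence "\<phi> t = R t * (\<phi> (t + a) / m)"
      using Rpos[OF t] \<open>m > 0\<close> \<phi>_nonneg by (subst (asm) ennreal_inj) auto
    moreover have "r + p * (t + a) = r + p * t + s"
      using \<open>p > 0\<close> by (simp add: a_def distrib_left)
    ultimately show ?thesis using Gpos Gpos'[OF t] \<open>m > 0\<close> by (simp add: R_def add.assoc)
  qed
  have log_convex: "(\<phi> (t + h))\<^sup>2 \<le> \<phi> t * \<phi> (t + 2 * h)" if "t \<ge> 0" "h > 0" for t h
  proof -
    have "ennreal ((\<phi> (t + h))\<^sup>2) \<le> ennreal (\<phi> t * \<phi> (t + 2 * h))"
      using mellin_log_convex[of \<mu> t h] mellin_eq[of t] mellin_eq[of "t + h"] mellin_eq[of "t + 2 * h"] that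
      by (simp add: assms(2) ennreal_power ennreal_mult \<phi>_nonneg)
    thus ?thesis by (subst (asm) ennreal_le_iff) (auto simp: \<phi>_nonneg)
  qed
  have bdd: "\<phi> t \<le> 1 + \<phi> a" if "0 \<le> t" "t \<le> a" for t
  proof -
    have "ennreal (\<phi> t) \<le> ennreal (1 + \<phi> a)"
      using le[OF that] mellin_eq[of t] mellin_eq[of a] that by (simp add: \<phi>_nonneg)
    thus ?thesis by (subst (asm) ennreal_le_iff) (auto simp: \<phi>_nonneg add_nonneg_nonneg)
  qed
  obtain c where "c > 0" "\<And>t. t \<ge> 0 \<Longrightarrow> \<phi> t = c powr t * (Gamma (r + p * t) / Gamma r)"
  proof (rule Bohr_Mollerup_with_period[OF \<open>a > 0\<close> \<open>p > 0\<close> \<open>r > 0\<close> _ \<phi>_pos log_convex bdd fe])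
    show "m * Gamma r / Gamma (r + s) > 0" using Gpos \<open>m > 0\<close> by simp
    show "\<phi> 0 = 1" by (simp add: \<phi>_def zero)
  qed auto
  thus ?thesis using that[of c] mellin_eq by simp
qed

text \<open>
  Both directions compare Mellin transforms. For the law of \<open>c G\<^sup>p\<close> the fixed-point equation reduces
  to the cancellation of \<open>Gamma (r + p t + s)\<close>, where \<open>c\<close> enters through the normalising moment
  \<open>m = c powr (s / p) * Gamma (r + s) / Gamma r\<close>.
\<close>
theorem proposition2p1:
  fixes M :: "'a measure" and L :: "'b measure" and N :: "'c measure"
    and W :: "'a \<Rightarrow> real" and G :: "'b \<Rightarrow> real" and B V :: "'c \<Rightarrow> real"
    and p r s :: real
  assumes "p > 0" and "r > 0" and "s > 0"
    and "prob_space M" and "W \<in> borel_measurable M" and "AE \<omega> in M. 0 \<le> W \<omega>"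
    and "integrable M (\<lambda>\<omega>. W \<omega> powr (s / p))"
    and "0 < (\<integral>\<omega>. W \<omega> powr (s / p) \<partial>M)"
    and "prob_space L" and "distributed L lborel G (\<lambda>x. ennreal (gamma_density r x))"
    and "prob_space N" and "distributed N lborel B (\<lambda>y. ennreal (beta_density r s y))"
    and "V \<in> borel_measurable N"
    and "distr N borel V = power_bias (s / p) (distr M borel W)"
    and "prob_space.indep_var N borel B borel V"
  shows "(\<exists>c>0. distr M borel W = distr L borel (\<lambda>\<omega>. c * G \<omega> powr p)) \<longleftrightarrow>
         distr M borel W = distr N borel (\<lambda>\<omega>. B \<omega> powr p * V \<omega>)"
proof -
  interpret M: prob_space M by fact
  interpret L: prob_space L by fact
  interpret N: prob_space N by fact
  note p = \<open>p > 0\<close> and r = \<open>r > 0\<close> and s = \<open>s > 0\<close>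
  note G_distr = \<open>distributed L lborel G (\<lambda>x. ennreal (gamma_density r x))\<close>
  note B_distr = \<open>distributed N lborel B (\<lambda>y. ennreal (beta_density r s y))\<close>
  note V_distr = \<open>distr N borel V = power_bias (s / p) (distr M borel W)\<close>
  have [measurable]: "W \<in> borel_measurable M" "V \<in> borel_measurable N" by fact+
  have [measurable]: "G \<in> borel_measurable L" "B \<in> borel_measurable N"
    using distributed_measurable[OF G_distr] distributed_measurable[OF B_distr] by simp_all
  define \<mu> where "\<mu> = distr M borel W"
  define \<tau> where "\<tau> = distr N borel (\<lambda>\<omega>. B \<omega> powr p * V \<omega>)"
  define \<gamma> where "\<gamma> = (\<lambda>c. distr L borel (\<lambda>\<omega>. c * G \<omega> powr p))"
  define m where "m = (\<integral>\<omega>. W \<omega> powr (s / p) \<partial>M)"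
  have m: "m > 0" unfolding m_def by fact
  have prob: "prob_space \<mu>" "prob_space \<tau>" "\<And>c. prob_space (\<gamma> c)"
    unfolding \<mu>_def \<tau>_def \<gamma>_def
    by (intro M.prob_space_distr N.prob_space_distr L.prob_space_distr; measurable)+
  have sets: "sets \<mu> = sets borel" "sets \<tau> = sets borel" "\<And>c. sets (\<gamma> c) = sets borel"
    by (simp_all add: \<mu>_def \<tau>_def \<gamma>_def)
  have m_eq: "m = (\<integral>y. \<bar>y\<bar> powr (s / p) \<partial>\<mu>)"
  proof -
    have "(\<integral>y. \<bar>y\<bar> powr (s / p) \<partial>\<mu>) = (\<integral>\<omega>. \<bar>W \<omega>\<bar> powr (s / p) \<partial>M)"
      unfolding \<mu>_def by (rule integral_distr) measurable
    thus ?thesis by (simp add: m_def abs_powr)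
  qed
  have mellin_m: "mellin \<mu> (s / p) = ennreal m"
    unfolding \<mu>_def m_def by (subst mellin_distr) (auto intro!: nn_integral_eq_integral assms)
  have mellin_\<tau>: "mellin \<tau> t =
      ennreal (Gamma (r + p * t) * Gamma (r + s) / (Gamma r * Gamma (r + p * t + s))) *
      (mellin \<mu> (t + s / p) / ennreal m)" if "t \<ge> 0" for t
  proof -
    have "r + p * t > 0" using p r that by (intro add_pos_nonneg) auto
    thus ?thesis
      unfolding \<tau>_def N.mellin_indep_product[OF assms(15)] V_distr
      using mellin_beta[OF B_distr r s] mellin_power_bias[OF sets(1) m_eq m]
      by (simp add: \<mu>_def)
  qed
  have mellin_\<gamma>: "mellin (\<gamma> c) t = ennreal (c powr t * (Gamma (r + p * t) / Gamma r))"
    if "t \<ge> 0" for c t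
    unfolding \<gamma>_def using p r that by (intro mellin_gamma_power[OF G_distr] add_pos_nonneg) auto
  have \<gamma>_pos: "AE x in \<gamma> c. x > 0" if "c > 0" for c
    unfolding \<gamma>_def by (rule L.AE_distr_gamma_power_pos[OF G_distr that])
  have \<tau>_pos: "AE x in \<tau>. x > 0"
  proof -
    have "AE x in \<mu>. x \<ge> 0"
      unfolding \<mu>_def using assms(6) by (subst AE_distr_iff) auto
    hence "AE x in power_bias (s / p) \<mu>. x \<ge> 0"
      unfolding power_bias_def by (subst AE_density) (auto simp: measurable_cong_sets[OF sets(1)])
    moreover have "AE x in power_bias (s / p) \<mu>. x \<noteq> 0"
      by (rule AE_power_bias_nonzero[OF sets(1)])
    ultimately have "AE x in distr N borel V. x > 0"
      unfolding V_distr \<mu>_def [symmetric] by eventually_elim auto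
    hence "AE \<omega> in N. V \<omega> > 0" by (subst (asm) AE_distr_iff) auto
    moreover have "AE \<omega> in N. B \<omega> > 0"
      by (subst N.distributed_AE2[OF B_distr]) (auto simp: beta_density_def)
    ultimately have "AE \<omega> in N. B \<omega> powr p * V \<omega> > 0" by eventually_elim auto
    thus ?thesis unfolding \<tau>_def by (subst AE_distr_iff) auto
  qed
  have "(\<exists>c>0. \<mu> = \<gamma> c) \<longleftrightarrow> \<mu> = \<tau>"
  proof
    assume "\<exists>c>0. \<mu> = \<gamma> c"
    then obtain c where c: "c > 0" "\<mu> = \<gamma> c" by blast
    have Gpos: "Gamma r > 0" "Gamma (r + s) > 0" using r s by (auto intro: Gamma_real_pos)
    have m_c: "m = c powr (s / p) * (Gamma (r + s) / Gamma r)"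
    proof -
      have "ennreal m = ennreal (c powr (s / p) * (Gamma (r + s) / Gamma r))"
        using mellin_\<gamma>[of "s / p" c] mellin_m c p s by simp
      thus ?thesis using m Gpos by (subst (asm) ennreal_inj) auto
    qed
    have same: "mellin \<mu> t = mellin \<tau> t" if t: "t \<ge> 0" for t
    proof -
      have G': "Gamma (r + p * t) > 0" "Gamma (r + p * t + s) > 0"
      proof -
        have "r + p * t > 0" using p r t by (intro add_pos_nonneg) auto
        thus "Gamma (r + p * t) > 0" "Gamma (r + p * t + s) > 0" using s by (auto intro: Gamma_real_pos)
      qed
      have shift: "r + p * (t + s / p) = r + p * t + s" using p by (simp add: distrib_left)
      define R where "R = Gamma (r + p * t) * Gamma (r + s) / (Gamma r * Gamma (r + p * t + s))"
      define X where "X = c powr (t + s / p) * (Gamma (r + p * t + s) / Gamma r)"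
      have nonneg: "R \<ge> 0" "X \<ge> 0" using Gpos G' by (simp_all add: R_def X_def)
      have "mellin \<tau> t = ennreal R * (mellin (\<gamma> c) (t + s / p) / ennreal m)"
        unfolding mellin_\<tau>[OF t] c(2) R_def ..
      also have "mellin (\<gamma> c) (t + s / p) = ennreal X"
        using mellin_\<gamma>[of "t + s / p" c] t p s unfolding shift X_def by simp
      also have "ennreal R * (ennreal X / ennreal m) = ennreal (R * (X / m))"
        using nonneg m by (simp only: divide_ennreal ennreal_mult' [symmetric])
      also have "R * (X / m) = c powr t * (Gamma (r + p * t) / Gamma r)"
        using c(1) Gpos G' by (simp add: R_def X_def m_c powr_add)
      finally show ?thesis using mellin_\<gamma>[OF t, of c] c(2) by simp
    qed
    show "\<mu> = \<tau>"
    proof (rule mellin_unique[OF prob(1) sets(1) _ prob(2) sets(2) \<tau>_pos zero_less_one])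
      show "AE x in \<mu>. x > 0" unfolding c(2) by (rule \<gamma>_pos[OF c(1)])
      show "mellin \<mu> t < \<infinity>" if "0 < t" for t using mellin_\<gamma>[of t c] c(2) that by simp
    qed (use same in auto)
  next
    assume eq: "\<mu> = \<tau>"
    have pos: "AE x in \<mu>. x > 0" unfolding eq by (rule \<tau>_pos)
    obtain c where c: "c > 0"
      "\<And>t. t \<ge> 0 \<Longrightarrow> mellin \<mu> t = ennreal (c powr t * (Gamma (r + p * t) / Gamma r))"
      using mellin_recurrence_solution[OF prob(1) sets(1) pos p r s m] mellin_m mellin_\<tau> eq
      by (metis ennreal_less_top infinity_ennreal_def)
    have "\<mu> = \<gamma> c"
      by (rule mellin_unique[OF prob(1) sets(1) pos prob(3) sets(3) \<gamma>_pos[OF c(1)] zero_less_one])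
         (use c(2) mellin_\<gamma> in auto)
    thus "\<exists>c>0. \<mu> = \<gamma> c" using c(1) by blast
  qed
  thus ?thesis unfolding \<mu>_def \<tau>_def \<gamma>_def .
qed

end
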